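(* Let $n\ge 2$, let $M$ be a complete noncompact $(n+1)$-dimensional finite volume hyperbolic Riemannian manifold, let $e$ be a cusp of $M$ with height function $\beta_e$ normalized such that $H_0$ is a sufficiently small cusp neighborhood, and let $c_0>0$. Then for each Euclidean $(n-1)$-sphere $S$ in $\tilde S_{c_0}\subset\mathbb R^n$, the set $\tilde{\mathcal B}_{h_1=c_0}\cap S$ is an absolute winning set in $S$.
   Context: Hyperbolic means constant sectional curvature $-1$; $M=\mathbb H^{n+1}/\Gamma$, $\gamma_v$ is the geodesic with initial vector $v\in SM$ (unit tangent bundle). Cusp data. A cusp $e$ is an asymptotic class of minimizing geodesic rays along which the injectivity radius tends to $0$. $\beta_e:M\to\mathbb R$ is a Busemann function associated to such a ray, such that $H_t:=\beta_e^{-1}((t,\infty))$ gives shrinking neighborhoods of the cusp as $t\to\infty$; it is renormalized so that $H_0$ is a sufficiently small cusp neighborhood, in particular $H_0$ lifts to a countable $\Gamma$-invariant collection of precisely invariant pairwise disjoint horoballs. $SH_0^+\subset SM$ is the $n$-dimensional submanifold of outward (away from the cusp) unit vectors orthogonal to $\partial H_0$. In the upper half-space model, normalize such that one lifted horoball is based at $\infty$ with Euclidean height $1$, and let $\Gamma_\infty$ be the stabilizer of $\infty$ in $\Gamma$, a discrete cocompact group of isometries of $\mathbb R^n$. Identify $x\in\mathbb R^n$ with the vertical geodesic starting on the boundary of that horoball and ending at $x$; projecting its initial vector to $M$ gives a surjective local isometry $\mathbb R^n\to\mathbb R^n/\Gamma_\infty=SH_0^+$, $x\mapsto v_x$. For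 $v\in SH_0^+$, $v$ is bounded if $\mathcal H(v)=\sup_{t\ge0}\beta_e(\gamma_v(t))<\infty$; $\mathcal B_{M,e,\beta_e}$ is the set of bounded vectors. The first height $h_1(v)$ is the value of $\beta_e\circ\gamma_v$ at the first time $t_1(v)\in[0,\infty)$ of a local maximum of $t\mapsto\beta_e(\gamma_v(t))$. $S_{c_0}$ is the set of all $v\in SH_0^+$ (not necessarily bounded) with $h_1(v)=c_0$; its preimage $\tilde S_{c_0}\subset\mathbb R^n$ under $x\mapsto v_x$ consists of a countable disjoint union of $(n-1)$-dimensional Euclidean spheres. $\tilde{\mathcal B}_{h_1=c_0}\subset\mathbb R^n$ is the preimage of $\mathcal B_{h_1=c_0}:=\mathcal B_{M,e,\beta_e}\cap S_{c_0}$. Absolute game. Let $\bar X$ be a proper metric space, $X\subset\bar X$ closed; fix $\beta_*>0$ and $0<\beta<\beta_*$. Bob starts with a metric ball $B_0=B(x_0,r_0)$, $x_0\in X$. At step $k\ge0$, given Bob's ball $B_k=B(x_k,r_k)$ with $x_k\in X$, Alice blocks a ball $A_k=B(y_k,\alpha_kr_k)$ with $y_k\in\bar X$ and $0<\alpha_k<\beta$; then Bob chooses $B_{k+1}=B(x_{k+1},r_{k+1})\subset B_k\setminus A_k$ with $x_{k+1}\in X$, $\beta r_k\le r_{k+1}\le r_k$. A set $Y\subset X$ is $\beta$-absolute winning in $X$ if Alice has a strategy guaranteeing that $\bigcap_{k\ge0}B_k$ meets $Y$, no matter how Bob plays; $Y$ is absolute winning in $X$ (given $\beta_*$) if it is $\beta$-absolute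 winning for all $0<\beta<\beta_*$. "Absolute winning" without mention of $\beta_*$ is understood for some fixed $\beta_*>0$ depending only on the pair $X\subset\bar X$. Here $X=S$ and $\bar X=\mathbb R^n$ with the Euclidean metric. *)

theory Defs
  imports "HOL-Analysis.Analysis"
begin

section \<open>Hyperbolic space: the upper half-space model\<close>

type_synonym 'n hpoint = "(real, 'n) vec \<times> real"

type_synonym 'n htangent = "'n hpoint \<times> 'n hpoint"

definition upper :: "('n::finite) hpoint set" where
  "upper = {p. 0 < snd p}"

definition hdist :: "('n::finite) hpoint \<Rightarrow> 'n hpoint \<Rightarrow> real" where
  "hdist p q = arcosh (1 + (dist p q)\<^sup>2 / (2 * snd p * snd q))"

definition hvol :: "('n::finite) hpoint measure" where
  "hvol = density lborel (\<lambda>p. indicator upper p * ennreal (1 / snd p ^ (CARD('n) + 1)))"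

text \<open>Isometries act as the identity outside the half-space, so that composition, identity and
  inverse of functions are those of the isometry group.\<close>

definition hisometry :: "(('n::finite) hpoint \<Rightarrow> 'n hpoint) \<Rightarrow> bool" where
  "hisometry g \<longleftrightarrow> bij_betw g upper upper
     \<and> (\<forall>p\<in>upper. \<forall>q\<in>upper. hdist (g p) (g q) = hdist p q)
     \<and> (\<forall>p. p \<notin> upper \<longrightarrow> g p = p)"

text \<open>Tangent vectors are pairs of a base point and a vector of the ambient Euclidean space. The
  hyperbolic norm of a tangent vector is its Euclidean norm divided by the height.\<close>

definition unit_tangent :: "('n::finite) htangent set" where
  "unit_tangent = {(p, w). p \<in> upper \<and> norm w = snd p}"

text \<open>The unit speed geodesic with a given initial unit vector; see the lemmas
  \<open>hgeodesic_0\<close>, \<open>hgeodesic_velocity\<close> and \<open>hdist_hgeodesic\<close>.\<close>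

definition hgeodesic :: "('n::finite) htangent \<Rightarrow> real \<Rightarrow> 'n hpoint" where
  "hgeodesic u t =
     (case u of ((x, h), (y, s)) \<Rightarrow>
        let D = cosh t - s / h * sinh t
        in (x + (sinh t / D) *\<^sub>R y, h / D))"

lemma hgeodesic_0: "hgeodesic (p, w) 0 = p"
  by (cases p; cases w) (simp add: hgeodesic_def)

lemma cosh_minus_mult_sinh_pos: assumes "\<bar>b\<bar> \<le> 1" shows "0 < cosh t - b * sinh (t::real)"
proof -
  have "b * sinh t \<le> \<bar>b\<bar> * \<bar>sinh t\<bar>" by (metis abs_ge_self abs_mult)
  also have "\<dots> \<le> \<bar>sinh t\<bar>" using assms by (simp add: mult_left_le_one_le)
  also have "\<dots> < cosh t"
  proof -
    have "(sinh t)^2 < (cosh t)^2" by (simp add: cosh_square_eq)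
    then show ?thesis by (metis cosh_real_nonneg power2_abs power2_less_imp_less)
  qed
  finally show ?thesis by simp
qed

lemma hgeodesic_velocity:
  assumes "(p, w) \<in> unit_tangent"
  shows "(hgeodesic (p, w) has_vector_derivative w) (at 0)"
proof -
  obtain x h y s where pw: "p = (x, h)" "w = (y, s)" by (cases p; cases w)
  have h: "h > 0" using assms by (simp add: pw unit_tangent_def upper_def)
  have "((\<lambda>t. sinh t / (cosh t - s / h * sinh t)) has_real_derivative 1) (at 0)"
    using h by (auto intro!: derivative_eq_intros)
  then have 1: "((\<lambda>t. x + (sinh t / (cosh t - s / h * sinh t)) *\<^sub>R y) has_vector_derivative y) (at 0)"
    using h by (auto intro!: derivative_eq_intros simp: has_real_derivative_iff_has_vector_derivative)
  have "((\<lambda>t. h / (cosh t - s / h * sinh t)) has_real_derivative s) (at 0)"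
    using h by (auto intro!: derivative_eq_intros)
  then have 2: "((\<lambda>t. h / (cosh t - s / h * sinh t)) has_vector_derivative s) (at 0)"
    by (simp add: has_real_derivative_iff_has_vector_derivative)
  have "hgeodesic (p, w) = (\<lambda>t. (x + (sinh t / (cosh t - s / h * sinh t)) *\<^sub>R y,
      h / (cosh t - s / h * sinh t)))"
    by (simp add: fun_eq_iff pw hgeodesic_def Let_def)
  then show ?thesis
    using has_vector_derivative_Pair[OF 1 2] by (simp add: pw)
qed

lemma hdist_hgeodesic:
  assumes "u \<in> unit_tangent"
  shows "hdist (hgeodesic u s) (hgeodesic u t) = \<bar>s - t\<bar>"
proof -
  obtain x h y k where u: "u = ((x, h), (y, k))" by (metis surj_pair)
  define b where "b = k / h"
  have h: "h > 0" and n: "norm (y, k) = h" using assms by (simp_all add: u unit_tangent_def upper_def)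
  have k: "k = b * h" using h by (simp add: b_def)
  have yk: "(norm y)\<^sup>2 + k\<^sup>2 = h\<^sup>2" using n h by (simp add: norm_Pair) (metis real_sqrt_pow2 sum_power2_ge_zero)
  then have y2: "(norm y)\<^sup>2 = h\<^sup>2 * (1 - b\<^sup>2)" by (simp add: k algebra_simps power_mult_distrib)
  have nn: "h\<^sup>2 * (1 - b\<^sup>2) \<ge> 0" by (metis y2 zero_le_power2)
  then have "b\<^sup>2 \<le> 1" using h by (simp add: zero_le_mult_iff)
  then have b: "\<bar>b\<bar> \<le> 1" by (simp add: abs_square_le_1)
  define D where "D t = cosh t - b * sinh t" for t :: real
  have Dp: "D t > 0" for t using cosh_minus_mult_sinh_pos[OF b] by (simp add: D_def)
  have e: "hgeodesic u t = (x + (sinh t / D t) *\<^sub>R y, h / D t)" for t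
    by (simp add: u hgeodesic_def D_def b_def Let_def)
  have "dist (x + (sinh s / D s) *\<^sub>R y) (x + (sinh t / D t) *\<^sub>R y) = \<bar>sinh s / D s - sinh t / D t\<bar> * norm y"
    by (simp add: dist_norm flip: scaleR_diff_left)
  then have d: "(dist (hgeodesic u s) (hgeodesic u t))\<^sup>2 
     = (sinh s / D s - sinh t / D t)\<^sup>2 * (h\<^sup>2 * (1 - b\<^sup>2)) + (h / D s - h / D t)\<^sup>2"
    by (simp add: e dist_Pair_Pair power_mult_distrib y2 dist_real_def nn)
  have "(dist (hgeodesic u s) (hgeodesic u t))\<^sup>2 / (2 * (h / D s) * (h / D t))
     = ((sinh s * D t - sinh t * D s)\<^sup>2 * (1 - b\<^sup>2) + (D t - D s)\<^sup>2) / (2 * D s * D t)"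
  proof -
    have nz: "D s \<noteq> 0" "D t \<noteq> 0" "h \<noteq> 0" using Dp[of s] Dp[of t] h by auto
    show ?thesis unfolding d using nz by (simp add: field_simps power2_eq_square)
  qed
  also have "sinh s * D t - sinh t * D s = sinh (s - t)"
    by (simp add: D_def sinh_diff algebra_simps)
  also have "(sinh (s - t))\<^sup>2 * (1 - b\<^sup>2) + (D t - D s)\<^sup>2 = 2 * D s * D t * (cosh (s - t) - 1)"
  proof -
    have c: "(cosh t)\<^sup>2 = (sinh t)\<^sup>2 + 1" "(cosh s)\<^sup>2 = (sinh s)\<^sup>2 + 1" by (simp_all add: cosh_square_eq)
    show ?thesis unfolding D_def sinh_diff cosh_diff using c by algebra
  qed
  finally have q: "(dist (hgeodesic u s) (hgeodesic u t))\<^sup>2 / (2 * (h / D s) * (h / D t)) = cosh (s - t) - 1"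
    using Dp[of s] Dp[of t] by simp
  have "hdist (hgeodesic u s) (hgeodesic u t) = arcosh (cosh (s - t))"
    using q by (simp add: hdist_def e)
  also have "\<dots> = arcosh (cosh \<bar>s - t\<bar>)" by (simp add: abs_if)  (metis cosh_minus minus_diff_eq)
  also have "\<dots> = \<bar>s - t\<bar>" by (rule arcosh_cosh_real) simp
  finally show ?thesis .
qed

text \<open>Open horoballs, based at infinity or at a point of the boundary \<open>t = 0\<close>.\<close>

definition horoball :: "('n::finite) hpoint set \<Rightarrow> bool" where
  "horoball B \<longleftrightarrow> (\<exists>s>0. B = {p. s < snd p}) \<or> (\<exists>y. \<exists>r>0. B = ball (y, r) r)"

text \<open>The metric is conformal to the Euclidean one and horoballs are convex in the Euclidean sense
  with smooth boundary, so the outward vectors orthogonal to the boundary at \<open>p\<close> are those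
  with the horoball on the negative side of their orthogonal hyperplane through \<open>p\<close>.\<close>

definition outward_unit_normals :: "('n::finite) hpoint set \<Rightarrow> 'n htangent set" where
  "outward_unit_normals B =
     {(p, w) \<in> unit_tangent. p \<in> frontier B \<and> (\<forall>q\<in>B. (q - p) \<bullet> w < 0)}"

section \<open>Hyperbolic manifolds as quotients\<close>

text \<open>The group \<open>\<Gamma>\<close> acts freely and properly discontinuously by isometries. By the
  Killing-Hopf theorem the quotients by such groups are the complete hyperbolic manifolds.\<close>

definition hyperbolic_group :: "(('n::finite) hpoint \<Rightarrow> 'n hpoint) set \<Rightarrow> bool" where
  "hyperbolic_group \<Gamma> \<longleftrightarrow>
     (\<forall>g\<in>\<Gamma>. hisometry g)
     \<and> id \<in> \<Gamma> \<and> (\<forall>g\<in>\<Gamma>. \<forall>h\<in>\<Gamma>. g \<circ> h \<in> \<Gamma>) \<and> (\<forall>g\<in>\<Gamma>. inv g \<in> \<Gamma>)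
     \<and> (\<forall>g\<in>\<Gamma>. \<forall>p\<in>upper. g p = p \<longrightarrow> g = id)
     \<and> (\<forall>p\<in>upper. \<forall>R. finite {g\<in>\<Gamma>. hdist p (g p) \<le> R})"

definition orbit :: "(('n::finite) hpoint \<Rightarrow> 'n hpoint) set \<Rightarrow> 'n hpoint \<Rightarrow> 'n hpoint set" where
  "orbit \<Gamma> p = (\<lambda>g. g p) ` \<Gamma>"

definition quot :: "(('n::finite) hpoint \<Rightarrow> 'n hpoint) set \<Rightarrow> 'n hpoint set set" where
  "quot \<Gamma> = orbit \<Gamma> ` upper"

definition qdist ::
    "(('n::finite) hpoint \<Rightarrow> 'n hpoint) set \<Rightarrow> 'n hpoint set \<Rightarrow> 'n hpoint set \<Rightarrow> real" where
  "qdist \<Gamma> P Q = Inf {hdist p q | p q. p \<in> P \<and> q \<in> Q}"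

text \<open>\<open>F\<close> meets every orbit exactly once, so its volume is the Riemannian volume of the quotient.\<close>

definition finite_volume :: "(('n::finite) hpoint \<Rightarrow> 'n hpoint) set \<Rightarrow> bool" where
  "finite_volume \<Gamma> \<longleftrightarrow>
     (\<exists>F\<in>sets borel. F \<subseteq> upper \<and> (\<forall>P\<in>quot \<Gamma>. \<exists>!p. p \<in> F \<inter> P) \<and> emeasure hvol F < \<infinity>)"

definition noncompact_quot :: "(('n::finite) hpoint \<Rightarrow> 'n hpoint) set \<Rightarrow> bool" where
  "noncompact_quot \<Gamma> \<longleftrightarrow> \<not> compact_space (Metric_space.mtopology (quot \<Gamma>) (qdist \<Gamma>))"

text \<open>The exponential map of the quotient at \<open>P\<close> is the exponential map of hyperbolic space at a
  lift \<open>p\<close>, which is a diffeomorphism, followed by the projection.\<close>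

definition inj_radius ::
    "(('n::finite) hpoint \<Rightarrow> 'n hpoint) set \<Rightarrow> 'n hpoint set \<Rightarrow> ereal" where
  "inj_radius \<Gamma> P =
     Sup {ereal r | r. 0 < r \<and> (\<exists>p\<in>P. inj_on (orbit \<Gamma>) {q\<in>upper. hdist p q < r})}"

text \<open>A unit tangent vector of the quotient is an orbit of unit tangent vectors under the
  differentials of the elements of \<open>\<Gamma>\<close>. The differential of \<open>g\<close> maps \<open>u\<close> to \<open>u'\<close> if and only
  if \<open>g\<close> maps the geodesic with initial vector \<open>u\<close> to the one with initial vector \<open>u'\<close>.\<close>

definition tproj ::
    "(('n::finite) hpoint \<Rightarrow> 'n hpoint) set \<Rightarrow> 'n htangent \<Rightarrow> 'n htangent set" where
  "tproj \<Gamma> u = {u'\<in>unit_tangent. \<exists>g\<in>\<Gamma>. \<forall>t. hgeodesic u' t = g (hgeodesic u t)}"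

text \<open>The geodesic \<open>\<gamma>\<^sub>v\<close>; the choice of the representative is immaterial.\<close>

definition qgeodesic ::
    "(('n::finite) hpoint \<Rightarrow> 'n hpoint) set \<Rightarrow> 'n htangent set \<Rightarrow> real \<Rightarrow> 'n hpoint set" where
  "qgeodesic \<Gamma> v t = orbit \<Gamma> (hgeodesic (SOME u. u \<in> v) t)"

section \<open>Cusps and height functions\<close>

text \<open>Rays are functions on \<open>real\<close> of which only the values on \<open>[0,\<infinity>)\<close> matter.\<close>

definition minimizing_ray ::
    "(('n::finite) hpoint \<Rightarrow> 'n hpoint) set \<Rightarrow> (real \<Rightarrow> 'n hpoint set) \<Rightarrow> bool" where
  "minimizing_ray \<Gamma> c \<longleftrightarrow>
     (\<forall>t\<ge>0. c t \<in> quot \<Gamma>) \<and> (\<forall>s\<ge>0. \<forall>t\<ge>0. qdist \<Gamma> (c s) (c t) = \<bar>s - t\<bar>)"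

definition cusp_ray ::
    "(('n::finite) hpoint \<Rightarrow> 'n hpoint) set \<Rightarrow> (real \<Rightarrow> 'n hpoint set) \<Rightarrow> bool" where
  "cusp_ray \<Gamma> c \<longleftrightarrow> minimizing_ray \<Gamma> c \<and> ((\<lambda>t. inj_radius \<Gamma> (c t)) \<longlongrightarrow> 0) at_top"

definition asymptotic ::
    "(('n::finite) hpoint \<Rightarrow> 'n hpoint) set \<Rightarrow> (real \<Rightarrow> 'n hpoint set) \<Rightarrow>
     (real \<Rightarrow> 'n hpoint set) \<Rightarrow> bool" where
  "asymptotic \<Gamma> c c' \<longleftrightarrow> (\<exists>K. \<forall>t\<ge>0. qdist \<Gamma> (c t) (c' t) \<le> K)"

definition cusps ::
    "(('n::finite) hpoint \<Rightarrow> 'n hpoint) set \<Rightarrow> (real \<Rightarrow> 'n hpoint set) set set" where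
  "cusps \<Gamma> = {{c'. cusp_ray \<Gamma> c' \<and> asymptotic \<Gamma> c c'} | c. cusp_ray \<Gamma> c}"

text \<open>The sign is such that the function increases along the ray.\<close>

definition busemann ::
    "(('n::finite) hpoint \<Rightarrow> 'n hpoint) set \<Rightarrow> (real \<Rightarrow> 'n hpoint set) \<Rightarrow> 'n hpoint set \<Rightarrow> real"
    where
  "busemann \<Gamma> c P = Lim at_top (\<lambda>t. t - qdist \<Gamma> P (c t))"

definition height_function ::
    "(('n::finite) hpoint \<Rightarrow> 'n hpoint) set \<Rightarrow> (real \<Rightarrow> 'n hpoint set) set \<Rightarrow>
     ('n hpoint set \<Rightarrow> real) \<Rightarrow> bool" where
  "height_function \<Gamma> e \<beta> \<longleftrightarrow> (\<exists>c\<in>e. \<exists>a. \<forall>P\<in>quot \<Gamma>. \<beta> P = busemann \<Gamma> c P + a)"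

text \<open>The set \<open>H\<^sub>0 = {\<beta> > 0}\<close> lifts to the collection \<open>\<H>\<close> of horoballs.\<close>

definition lifted_horoballs ::
    "(('n::finite) hpoint \<Rightarrow> 'n hpoint) set \<Rightarrow> ('n hpoint set \<Rightarrow> real) \<Rightarrow> 'n hpoint set set \<Rightarrow> bool"
    where
  "lifted_horoballs \<Gamma> \<beta> \<H> \<longleftrightarrow>
     \<Union>\<H> = {p\<in>upper. 0 < \<beta> (orbit \<Gamma> p)}
     \<and> countable \<H> \<and> (\<forall>B\<in>\<H>. horoball B) \<and> disjoint \<H>
     \<and> (\<forall>g\<in>\<Gamma>. \<forall>B\<in>\<H>. g ` B \<in> \<H> \<and> (g ` B = B \<or> g ` B \<inter> B = {}))"

text \<open>The set \<open>SH\<^sub>0\<^sup>+\<close>.\<close>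

definition SH0_plus ::
    "(('n::finite) hpoint \<Rightarrow> 'n hpoint) set \<Rightarrow> 'n hpoint set set \<Rightarrow> 'n htangent set set" where
  "SH0_plus \<Gamma> \<H> = (\<Union>B\<in>\<H>. tproj \<Gamma> ` outward_unit_normals B)"

text \<open>The map \<open>x \<mapsto> v\<^sub>x\<close>, for the lifted horoball \<open>{t > 1}\<close>.\<close>

definition vertical :: "(('n::finite) hpoint \<Rightarrow> 'n hpoint) set \<Rightarrow> real^'n \<Rightarrow> 'n htangent set" where
  "vertical \<Gamma> x = tproj \<Gamma> ((x, 1), (0, -1))"

section \<open>Bounded vectors and first heights\<close>

definition total_height ::
    "(('n::finite) hpoint \<Rightarrow> 'n hpoint) set \<Rightarrow> ('n hpoint set \<Rightarrow> real) \<Rightarrow> 'n htangent set \<Rightarrow> ereal"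
    where
  "total_height \<Gamma> \<beta> v = (SUP t\<in>{0..}. ereal (\<beta> (qgeodesic \<Gamma> v t)))"

definition bounded_vectors ::
    "(('n::finite) hpoint \<Rightarrow> 'n hpoint) set \<Rightarrow> ('n hpoint set \<Rightarrow> real) \<Rightarrow> 'n hpoint set set \<Rightarrow>
     'n htangent set set" where
  "bounded_vectors \<Gamma> \<beta> \<H> = {v\<in>SH0_plus \<Gamma> \<H>. total_height \<Gamma> \<beta> v < \<infinity>}"

definition local_max_at :: "(real \<Rightarrow> real) \<Rightarrow> real \<Rightarrow> bool" where
  "local_max_at f t \<longleftrightarrow> (\<forall>\<^sub>F s in nhds t. f s \<le> f t)"

text \<open>The value of \<open>f\<close> at its first local maximum in \<open>[0,\<infinity>)\<close> is \<open>h\<close>. Local maxima are those of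
  \<open>f\<close> as a function on the whole real line: the restriction of the height to \<open>[0,\<infinity>)\<close> along
  a vector of \<open>SH\<^sub>0\<^sup>+\<close> always has a boundary maximum at \<open>0\<close>, which does not count.
  There need not be any local maximum, whence a relation instead of a function.\<close>

definition has_first_max_value :: "(real \<Rightarrow> real) \<Rightarrow> real \<Rightarrow> bool" where
  "has_first_max_value f h \<longleftrightarrow>
     (\<exists>t\<ge>0. local_max_at f t \<and> (\<forall>s. 0 \<le> s \<and> s < t \<longrightarrow> \<not> local_max_at f s) \<and> f t = h)"

definition first_height_set ::
    "(('n::finite) hpoint \<Rightarrow> 'n hpoint) set \<Rightarrow> ('n hpoint set \<Rightarrow> real) \<Rightarrow> 'n hpoint set set \<Rightarrow>
     real \<Rightarrow> 'n htangent set set" where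
  "first_height_set \<Gamma> \<beta> \<H> c0 =
     {v\<in>SH0_plus \<Gamma> \<H>. has_first_max_value (\<lambda>t. \<beta> (qgeodesic \<Gamma> v t)) c0}"

text \<open>Preimages in \<open>real^'n\<close> of \<open>S\<^sub>c\<^sub>0\<close> and of its bounded vectors.\<close>

definition S_tilde ::
    "(('n::finite) hpoint \<Rightarrow> 'n hpoint) set \<Rightarrow> ('n hpoint set \<Rightarrow> real) \<Rightarrow> 'n hpoint set set \<Rightarrow>
     real \<Rightarrow> (real^'n) set" where
  "S_tilde \<Gamma> \<beta> \<H> c0 = vertical \<Gamma> -` first_height_set \<Gamma> \<beta> \<H> c0"

definition B_tilde ::
    "(('n::finite) hpoint \<Rightarrow> 'n hpoint) set \<Rightarrow> ('n hpoint set \<Rightarrow> real) \<Rightarrow> 'n hpoint set set \<Rightarrow>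
     real \<Rightarrow> (real^'n) set" where
  "B_tilde \<Gamma> \<beta> \<H> c0 =
     vertical \<Gamma> -` (bounded_vectors \<Gamma> \<beta> \<H> \<inter> first_height_set \<Gamma> \<beta> \<H> c0)"

section \<open>The absolute game\<close>

text \<open>The ambient space is the whole type. A move of Bob is a pair of centre and radius; a strategy
  \<open>\<sigma>\<close> maps the list of Bob's moves \<open>B\<^sub>0, \<dots>, B\<^sub>k\<close> to the pair of \<open>y\<^sub>k\<close> and \<open>\<alpha>\<^sub>k\<close>. Balls are closed.
  Only infinite plays are considered, so Bob loses if he runs out of legal moves. With this convention
  \<open>\<beta>\<close>-absolute winning implies \<open>\<beta>'\<close>-absolute winning for all \<open>\<beta>' > \<beta>\<close>, so that
  what counts is winning for arbitrarily small \<open>\<beta>\<close>.\<close>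

definition legal_play ::
    "'a::metric_space set \<Rightarrow> real \<Rightarrow> (('a \<times> real) list \<Rightarrow> 'a \<times> real) \<Rightarrow> (nat \<Rightarrow> 'a \<times> real) \<Rightarrow> bool"
    where
  "legal_play X \<beta> \<sigma> B \<longleftrightarrow>
     0 < snd (B 0) \<and> (\<forall>k. fst (B k) \<in> X)
     \<and> (\<forall>k. let (x, r) = B k; (x', r') = B (Suc k); (y, \<alpha>) = \<sigma> (map B [0..<Suc k])
            in cball x' r' \<subseteq> cball x r - cball y (\<alpha> * r) \<and> \<beta> * r \<le> r' \<and> r' \<le> r)"

definition beta_absolute_winning :: "real \<Rightarrow> 'a::metric_space set \<Rightarrow> 'a set \<Rightarrow> bool" where
  "beta_absolute_winning \<beta> X Y \<longleftrightarrow>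
     Y \<subseteq> X \<and>
     (\<exists>\<sigma>. (\<forall>bs. 0 < snd (\<sigma> bs) \<and> snd (\<sigma> bs) < \<beta>)
        \<and> (\<forall>B. legal_play X \<beta> \<sigma> B \<longrightarrow> (\<Inter>k. cball (fst (B k)) (snd (B k))) \<inter> Y \<noteq> {}))"

definition absolute_winning :: "real \<Rightarrow> 'a::metric_space set \<Rightarrow> 'a set \<Rightarrow> bool" where
  "absolute_winning b X Y \<longleftrightarrow> (\<forall>\<beta>. 0 < \<beta> \<and> \<beta> < b \<longrightarrow> beta_absolute_winning \<beta> X Y)"

end

theory Submission
  imports Defs
begin

text \<open>The vertical geodesic over \<open>x\<close> can only reach a great height by going deep into one of the lifted
  horoballs other than \<open>{p. 1 < snd p}\<close>, since the height function is nonpositive outside the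
  horoballs and Lipschitz for the hyperbolic distance
  (\<open>height_function_lipschitz\<close>). Its depth in the horoball \<open>ball (y, r) r\<close> is controlled by
  the ratio \<open>\<bar>x - y\<bar> / r\<close> (\<open>vertical_depth_in_horoball\<close>). So the vector at \<open>x\<close> is bounded as soon as
  this ratio is bounded below uniformly in the horoballs
  (\<open>total_height_vertical_finite\<close>), a Diophantine condition on \<open>x\<close>.

  Disjointness of the horoballs makes large ones sparse: \<open>\<bar>y - y'\<bar>\<^sup>2 \<ge> 4 r r'\<close>
  (\<open>sparse_sizes_horoball_bases\<close>). Hence at every scale at most one horoball of at least that size
  threatens Bob's ball, and Alice can block a neighbourhood of its base point. She does this at
  every other step. In between she blocks the centre of Bob's ball, so that his radius tends to
  zero and every scale is passed. Each horoball is therefore handled at a scale comparable to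
  its radius, which gives the uniform lower bound on the ratio. The strategy blocks balls of
  the ambient space, so it works in the same way when Bob's centres are restricted to any closed
  set (\<open>beta_absolute_winning_badly_approximable\<close>), in particular to a sphere. Membership of
  the outcome in the first height set is automatic, since the whole sphere lies in its
  preimage.\<close>

section \<open>The distance on hyperbolic space and on its quotients\<close>

definition hcosh :: "('n::finite) hpoint \<Rightarrow> 'n hpoint \<Rightarrow> real" where
  "hcosh p q = 1 + (dist p q)\<^sup>2 / (2 * snd p * snd q)"

lemma arcosh_le: "1 \<le> x \<Longrightarrow> x \<le> y \<Longrightarrow> arcosh x \<le> arcosh (y::real)"
  using arcosh_real_strict_mono[of x y] by (cases "x = y") (simp_all del: arcosh_less_iff_real)

lemma hcosh_ge_1: "p \<in> upper \<Longrightarrow> q \<in> upper \<Longrightarrow> 1 \<le> hcosh p q"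
  by (simp add: hcosh_def upper_def)

lemma hdist_eq_arcosh: "hdist p q = arcosh (hcosh p q)"
  by (simp add: hdist_def hcosh_def)

lemma hdist_nonneg: "p \<in> upper \<Longrightarrow> q \<in> upper \<Longrightarrow> 0 \<le> hdist p q"
  unfolding hdist_eq_arcosh by (rule arcosh_nonneg_real, rule hcosh_ge_1)

lemma hdist_commute: "hdist p q = hdist q p"
  by (simp add: hdist_def dist_commute mult.commute mult.left_commute)

text \<open>In the hyperboloid model \<open>cosh (hdist z w)\<close> is minus the Lorentz product of \<open>z\<close> and \<open>w\<close>. Here it is
  split into the parts along and orthogonal to a base point \<open>q\<close> at height \<open>v\<close>, where \<open>h\<close> and \<open>k\<close>
  are the heights of \<open>z\<close> and \<open>w\<close>, and \<open>A\<close>, \<open>B\<close>, \<open>D\<close> the inner products of their horizontal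
  displacements from \<open>q\<close>.\<close>

lemma lorentz_form_identity:
  fixes A B D h k v :: real
  assumes "0 < h" "0 < k" "0 < v"
  shows "(1 + (A + (h - v)\<^sup>2) / (2 * h * v)) * (1 + (B + (k - v)\<^sup>2) / (2 * k * v))
      - (D / (h * k) + (A + h\<^sup>2 - v\<^sup>2) * (B + k\<^sup>2 - v\<^sup>2) / (4 * v\<^sup>2 * h * k))
    = 1 + (A - 2 * D + B + (h - k)\<^sup>2) / (2 * h * k)"
proof -
  have 1: "1 + (A + (h - v)\<^sup>2) / (2 * h * v) = (A + h\<^sup>2 + v\<^sup>2) / (2 * h * v)"
    and 2: "1 + (B + (k - v)\<^sup>2) / (2 * k * v) = (B + k\<^sup>2 + v\<^sup>2) / (2 * k * v)"
    and 3: "1 + (A - 2 * D + B + (h - k)\<^sup>2) / (2 * h * k) = (A - 2 * D + B + h\<^sup>2 + k\<^sup>2) / (2 * h * k)"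
    using assms by (simp_all add: divide_simps) (simp_all add: power2_eq_square algebra_simps)
  have "(A + h\<^sup>2 + v\<^sup>2) * (B + k\<^sup>2 + v\<^sup>2) - (4 * v\<^sup>2 * D + (A + h\<^sup>2 - v\<^sup>2) * (B + k\<^sup>2 - v\<^sup>2))
      = 2 * v\<^sup>2 * (A - 2 * D + B + h\<^sup>2 + k\<^sup>2)"
    by algebra
  then have "((A + h\<^sup>2 + v\<^sup>2) * (B + k\<^sup>2 + v\<^sup>2)
        - (4 * v\<^sup>2 * D + (A + h\<^sup>2 - v\<^sup>2) * (B + k\<^sup>2 - v\<^sup>2))) / (4 * v\<^sup>2 * h * k)
      = (2 * v\<^sup>2) * (A - 2 * D + B + h\<^sup>2 + k\<^sup>2) / ((2 * v\<^sup>2) * (2 * h * k))"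
    by (simp add: mult_ac)
  then have "((A + h\<^sup>2 + v\<^sup>2) * (B + k\<^sup>2 + v\<^sup>2)
        - (4 * v\<^sup>2 * D + (A + h\<^sup>2 - v\<^sup>2) * (B + k\<^sup>2 - v\<^sup>2))) / (4 * v\<^sup>2 * h * k)
      = (A - 2 * D + B + h\<^sup>2 + k\<^sup>2) / (2 * h * k)"
    using assms(3) by (subst (asm) mult_divide_mult_cancel_left) auto
  moreover have "(A + h\<^sup>2 + v\<^sup>2) / (2 * h * v) * ((B + k\<^sup>2 + v\<^sup>2) / (2 * k * v))
      = (A + h\<^sup>2 + v\<^sup>2) * (B + k\<^sup>2 + v\<^sup>2) / (4 * v\<^sup>2 * h * k)"
    "D / (h * k) = 4 * v\<^sup>2 * D / (4 * v\<^sup>2 * h * k)"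
    using assms by (simp_all add: power2_eq_square)
  ultimately show ?thesis
    unfolding 1 2 3 by (simp add: diff_divide_distrib add_divide_distrib)
qed

text \<open>The orthogonal complement of \<open>q\<close> for the Lorentz form is Euclidean, so Cauchy-Schwarz on it bounds
  \<open>cosh (hdist p r)\<close> by the right-hand side of the addition formula for \<open>cosh\<close>.\<close>

lemma hdist_triangle:
  fixes p q r :: "('n::finite) hpoint"
  assumes "p \<in> upper" "q \<in> upper" "r \<in> upper"
  shows "hdist p r \<le> hdist p q + hdist q r"
proof -
  obtain v where v: "v = snd q" "v > 0" using assms by (simp add: upper_def)
  \<comment> \<open>The component of \<open>z\<close> orthogonal to \<open>q\<close>, in an orthonormal basis of that complement.\<close>
  define F where "F z = ((1 / snd z) *\<^sub>R (fst z - fst q),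
    ((fst z - fst q) \<bullet> (fst z - fst q) + (snd z)\<^sup>2 - v\<^sup>2) / (2 * v * snd z))" for z
  have lorentz: "hcosh z q * hcosh w q - F z \<bullet> F w = hcosh z w" if zw: "z \<in> upper" "w \<in> upper" for z w
  proof -
    obtain x h where z: "z = (x, h)" "h > 0" using zw(1) by (cases z) (auto simp: upper_def)
    obtain y k where w: "w = (y, k)" "k > 0" using zw(2) by (cases w) (auto simp: upper_def)
    obtain a where q: "q = (a, v)" using v by (cases q) simp
    define X Y where "X = x - a" and "Y = y - a"
    have xy: "x = X + a" "y = Y + a" by (simp_all add: X_def Y_def)
    have d: "(dist z q)\<^sup>2 = X \<bullet> X + (h - v)\<^sup>2" "(dist w q)\<^sup>2 = Y \<bullet> Y + (k - v)\<^sup>2"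
       "(dist z w)\<^sup>2 = X \<bullet> X - 2 * (X \<bullet> Y) + Y \<bullet> Y + (h - k)\<^sup>2"
      by (simp_all add: z w q dist_Pair_Pair dist_real_def xy)
         (simp_all add: dist_norm power2_norm_eq_inner inner_diff inner_commute)
    have F: "F z \<bullet> F w = (X \<bullet> Y) / (h * k)
        + (X \<bullet> X + h\<^sup>2 - v\<^sup>2) * (Y \<bullet> Y + k\<^sup>2 - v\<^sup>2) / (4 * v\<^sup>2 * h * k)"
      by (simp add: F_def z w q xy power2_eq_square mult_ac)
    have "hcosh z q = 1 + (X \<bullet> X + (h - v)\<^sup>2) / (2 * h * v)"
      "hcosh w q = 1 + (Y \<bullet> Y + (k - v)\<^sup>2) / (2 * k * v)"
      "hcosh z w = 1 + (X \<bullet> X - 2 * (X \<bullet> Y) + Y \<bullet> Y + (h - k)\<^sup>2) / (2 * h * k)"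
      unfolding hcosh_def d by (simp_all add: z w q)
    then show ?thesis using lorentz_form_identity[OF z(2) w(2) v(2)] by (simp add: F)
  qed
  have norm_F: "norm (F z) = sinh (hdist z q)" if "z \<in> upper" for z
  proof -
    have "(norm (F z))\<^sup>2 = (hcosh z q)\<^sup>2 - 1"
      using lorentz[OF that that] hcosh_def[of z z]
      by (simp add: power2_norm_eq_inner power2_eq_square[of "hcosh z q"])
    then show ?thesis
      using hcosh_ge_1[OF that assms(2)]
      by (simp add: hdist_eq_arcosh sinh_arcosh_real real_sqrt_unique)
  qed
  have cosh_hdist: "cosh (hdist z q) = hcosh z q" if "z \<in> upper" for z
    using hcosh_ge_1[OF that assms(2)] by (simp add: hdist_eq_arcosh)
  have "hcosh p r \<le> hcosh p q * hcosh r q + norm (F p) * norm (F r)"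
    using lorentz[OF assms(1,3)] Cauchy_Schwarz_ineq2[of "F p" "F r"] by linarith
  also have "\<dots> = cosh (hdist p q + hdist r q)"
    using assms by (simp add: cosh_add norm_F cosh_hdist)
  finally have "hcosh p r \<le> cosh (hdist p q + hdist r q)" .
  then have "hdist p r \<le> arcosh (cosh (hdist p q + hdist r q))"
    unfolding hdist_eq_arcosh[of p r] using hcosh_ge_1[OF assms(1,3)]
    by (intro arcosh_le) auto
  also have "\<dots> = hdist p q + hdist r q"
    using assms by (intro arcosh_cosh_real add_nonneg_nonneg hdist_nonneg)
  finally show ?thesis by (simp add: hdist_commute)
qed

lemma hyperbolic_groupD:
  assumes "hyperbolic_group \<Gamma>" "g \<in> \<Gamma>"
  shows "p \<in> upper \<Longrightarrow> g p \<in> upper"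
    and "p \<in> upper \<Longrightarrow> q \<in> upper \<Longrightarrow> hdist (g p) (g q) = hdist p q"
    and "inv g \<in> \<Gamma>" and "inv g (g p) = p"
    and "h \<in> \<Gamma> \<Longrightarrow> g \<circ> h \<in> \<Gamma>"
proof -
  have iso: "hisometry g" using assms by (simp add: hyperbolic_group_def)
  then have bij: "bij_betw g upper upper" by (simp add: hisometry_def)
  show "p \<in> upper \<Longrightarrow> g p \<in> upper" using bij by (auto simp: bij_betw_def)
  show "p \<in> upper \<Longrightarrow> q \<in> upper \<Longrightarrow> hdist (g p) (g q) = hdist p q"
    using iso by (simp add: hisometry_def)
  show "inv g \<in> \<Gamma>" "h \<in> \<Gamma> \<Longrightarrow> g \<circ> h \<in> \<Gamma>"
    using assms by (simp_all add: hyperbolic_group_def)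
  have "inj g"
  proof (rule injI)
    fix p q assume e: "g p = g q"
    show "p = q"
    proof (cases "p \<in> upper \<and> q \<in> upper")
      case True then show ?thesis using bij e by (auto simp: bij_betw_def inj_on_def)
    next
      case False then show ?thesis using iso bij e
        by (metis (no_types, lifting) bij_betw_imp_surj_on hisometry_def image_eqI)
    qed
  qed
  then show "inv g (g p) = p" by simp
qed

lemma quotD:
  assumes "hyperbolic_group \<Gamma>" "P \<in> quot \<Gamma>"
  shows "P \<noteq> {}" and "P \<subseteq> upper"
    and "p \<in> P \<Longrightarrow> q \<in> P \<Longrightarrow> \<exists>g\<in>\<Gamma>. q = g p"
    and "p \<in> P \<Longrightarrow> g \<in> \<Gamma> \<Longrightarrow> g p \<in> P"
proof -
  obtain z where z: "z \<in> upper" "P = (\<lambda>g. g z) ` \<Gamma>"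
    using assms(2) by (auto simp: quot_def orbit_def)
  note D = hyperbolic_groupD[OF assms(1)]
  show "P \<noteq> {}" using z assms by (auto simp: hyperbolic_group_def)
  show "P \<subseteq> upper" unfolding z(2) using z(1) D(1) by blast
  show "\<exists>g\<in>\<Gamma>. q = g p" if pq: "p \<in> P" "q \<in> P"
  proof -
    obtain g h where "g \<in> \<Gamma>" "p = g z" "h \<in> \<Gamma>" "q = h z" using z pq by auto
    then show ?thesis using D(3,4,5) by (intro bexI[of _ "h \<circ> inv g"]) auto
  qed
  show "g p \<in> P" if pg: "p \<in> P" "g \<in> \<Gamma>"
  proof -
    obtain h where "h \<in> \<Gamma>" "p = h z" using z pg by auto
    then show ?thesis using D(5)[of g h] pg z by (auto intro!: image_eqI[of _ _ "g \<circ> h"])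
  qed
qed

lemma orbit_in_quot: "p \<in> upper \<Longrightarrow> orbit \<Gamma> p \<in> quot \<Gamma>"
  by (simp add: quot_def)

lemma qdist_le_hdist:
  assumes "hyperbolic_group \<Gamma>" "P \<in> quot \<Gamma>" "Q \<in> quot \<Gamma>" "p \<in> P" "q \<in> Q"
  shows "qdist \<Gamma> P Q \<le> hdist p q"
proof -
  have "bdd_below {hdist p q |p q. p \<in> P \<and> q \<in> Q}"
    using quotD(2)[OF assms(1,2)] quotD(2)[OF assms(1,3)]
    by (intro bdd_belowI[of _ 0]) (auto intro!: hdist_nonneg)
  then show ?thesis unfolding qdist_def using assms(4,5) by (intro cInf_lower) blast
qed

text \<open>Two pairs of lifts that nearly realize the distances need not share their lift of \<open>Q\<close>; an element of
  \<open>\<Gamma>\<close> moves the second pair so that they do.\<close>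

lemma qdist_triangle:
  assumes "hyperbolic_group \<Gamma>" "P \<in> quot \<Gamma>" "Q \<in> quot \<Gamma>" "R \<in> quot \<Gamma>"
  shows "qdist \<Gamma> P R \<le> qdist \<Gamma> P Q + qdist \<Gamma> Q R"
proof -
  note D = quotD[OF assms(1,2)] quotD[OF assms(1,3)] quotD[OF assms(1,4)]
  have *: "qdist \<Gamma> P R \<le> hdist p q + hdist q' r"
    if "p \<in> P" "q \<in> Q" "q' \<in> Q" "r \<in> R" for p q q' r
  proof -
    obtain g where g: "g \<in> \<Gamma>" "q = g q'" using D(7) \<open>q \<in> Q\<close> \<open>q' \<in> Q\<close> by blast
    have "qdist \<Gamma> P R \<le> hdist p (g r)"
      using that g D(12) by (intro qdist_le_hdist[OF assms(1,2,4)])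
    also have "\<dots> \<le> hdist p q + hdist q (g r)"
      using that g D(2,6,10) D(12)[OF that(4) g(1)] by (intro hdist_triangle) blast+
    also have "hdist q (g r) = hdist q' r"
      using that g(2) D(6,10) hyperbolic_groupD(2)[OF assms(1) g(1), of q' r] by blast
    finally show ?thesis .
  qed
  have "qdist \<Gamma> P R - hdist p q \<le> qdist \<Gamma> Q R" if "p \<in> P" "q \<in> Q" for p q
    unfolding qdist_def[of \<Gamma> Q R] using that D(5) D(9) *[OF that]
    by (intro cInf_greatest) (fastforce simp: algebra_simps)+
  then have "qdist \<Gamma> P R - qdist \<Gamma> Q R \<le> qdist \<Gamma> P Q"
    unfolding qdist_def[of \<Gamma> P Q] using D(1) D(5)
    by (intro cInf_greatest) (fastforce simp: algebra_simps)+
  then show ?thesis by simp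
qed

section \<open>Busemann functions\<close>

text \<open>The limit in the definition exists because \<open>t - qdist \<Gamma> P (c t)\<close> is nondecreasing in \<open>t\<close> and bounded by the
  distance from \<open>P\<close> to \<open>c 0\<close>, both by the triangle inequality along the minimizing ray.\<close>

lemma tendsto_busemann:
  assumes \<Gamma>: "hyperbolic_group \<Gamma>" and c: "minimizing_ray \<Gamma> c" and P: "P \<in> quot \<Gamma>"
  shows "((\<lambda>t. t - qdist \<Gamma> P (c t)) \<longlongrightarrow> busemann \<Gamma> c P) at_top"
proof -
  let ?f = "\<lambda>t. t - qdist \<Gamma> P (c t)"
  have cq: "c t \<in> quot \<Gamma>" if "t \<ge> 0" for t using c that by (simp add: minimizing_ray_def)
  have cd: "qdist \<Gamma> (c s) (c t) = \<bar>s - t\<bar>" if "s \<ge> 0" "t \<ge> 0" for s t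
    using c that by (simp add: minimizing_ray_def)
  have mono: "?f s \<le> ?f t" if "0 \<le> s" "s \<le> t" for s t
    using qdist_triangle[OF \<Gamma> P cq[of s] cq[of t]] cd[of s t] that by auto
  have bdd: "?f t \<le> qdist \<Gamma> (c 0) P" if "0 \<le> t" for t
    using qdist_triangle[OF \<Gamma> cq[of 0] P cq[of t]] cd[of 0 t] that by auto
  have bdd': "bdd_above (?f ` {0..})"
    using bdd by (intro bdd_aboveI2[of _ _ "qdist \<Gamma> (c 0) P"]) auto
  have "(?f \<longlongrightarrow> (SUP t\<in>{0..}. ?f t)) at_top"
  proof (rule increasing_tendsto)
    show "\<forall>\<^sub>F t in at_top. ?f t \<le> (SUP t\<in>{0..}. ?f t)"
      using eventually_ge_at_top[of 0] by eventually_elim (auto intro!: cSUP_upper bdd')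
    fix l assume "l < (SUP t\<in>{0..}. ?f t)"
    then obtain s where s: "s \<ge> 0" "l < ?f s"
      by (subst (asm) less_cSUP_iff) (use bdd' in auto)
    show "\<forall>\<^sub>F t in at_top. l < ?f t"
      using eventually_ge_at_top[of s] by eventually_elim (use s mono in fastforce)
  qed
  then show ?thesis unfolding busemann_def by (metis tendsto_Lim trivial_limit_at_top_linorder)
qed

lemma busemann_le:
  assumes \<Gamma>: "hyperbolic_group \<Gamma>" and c: "minimizing_ray \<Gamma> c"
    and P: "P \<in> quot \<Gamma>" and Q: "Q \<in> quot \<Gamma>"
  shows "busemann \<Gamma> c P \<le> busemann \<Gamma> c Q + qdist \<Gamma> Q P"
proof (rule tendsto_le[OF _ _ tendsto_busemann[OF \<Gamma> c P]])
  show "((\<lambda>t. t - qdist \<Gamma> Q (c t) + qdist \<Gamma> Q P) \<longlongrightarrow> busemann \<Gamma> c Q + qdist \<Gamma> Q P) at_top"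
    by (intro tendsto_intros tendsto_busemann[OF \<Gamma> c Q])
  show "\<forall>\<^sub>F t in at_top. t - qdist \<Gamma> P (c t) \<le> t - qdist \<Gamma> Q (c t) + qdist \<Gamma> Q P"
    using eventually_ge_at_top[of 0]
  proof eventually_elim
    case (elim t)
    then have "c t \<in> quot \<Gamma>" using c by (simp add: minimizing_ray_def)
    from qdist_triangle[OF \<Gamma> Q P this] show ?case by simp
  qed
qed simp

lemma height_function_lipschitz:
  assumes "hyperbolic_group \<Gamma>" "e \<in> cusps \<Gamma>" "height_function \<Gamma> e \<beta>" "p \<in> upper" "q \<in> upper"
  shows "\<beta> (orbit \<Gamma> p) \<le> \<beta> (orbit \<Gamma> q) + hdist p q"
proof -
  obtain c a where c: "c \<in> e" and \<beta>: "\<And>P. P \<in> quot \<Gamma> \<Longrightarrow> \<beta> P = busemann \<Gamma> c P + a"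
    using assms(3) by (auto simp: height_function_def)
  have ray: "minimizing_ray \<Gamma> c"
    using c assms(2) by (auto simp: cusps_def cusp_ray_def)
  have mem: "z \<in> orbit \<Gamma> z" for z
    using assms(1) by (auto simp: orbit_def hyperbolic_group_def intro!: image_eqI[of _ _ id])
  note O = orbit_in_quot[OF assms(4), of \<Gamma>] orbit_in_quot[OF assms(5), of \<Gamma>]
  have "busemann \<Gamma> c (orbit \<Gamma> p) \<le> busemann \<Gamma> c (orbit \<Gamma> q) + qdist \<Gamma> (orbit \<Gamma> q) (orbit \<Gamma> p)"
    by (rule busemann_le[OF assms(1) ray O])
  also have "qdist \<Gamma> (orbit \<Gamma> q) (orbit \<Gamma> p) \<le> hdist q p"
    by (rule qdist_le_hdist[OF assms(1) O(2,1) mem mem])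
  finally show ?thesis using O by (simp add: \<beta> hdist_commute)
qed

section \<open>An absolute game for badly approximable points\<close>

text \<open>A ball of radius \<open>r'\<close> inside one of radius \<open>r\<close> has its centre at distance at most \<open>r - r'\<close> from the
  big centre, and more than \<open>r'\<close> if it misses that centre. So by blocking a small concentric ball
  Alice forces Bob to halve his radius.\<close>

lemma cball_avoiding_centre_radius:
  fixes x x' :: "'a::euclidean_space"
  assumes "cball x' r' \<subseteq> cball x r - cball x s" "0 \<le> s" "0 \<le> r'"
  shows "r' < r / 2"
proof -
  have "dist x' x + r' \<le> r"
    using assms cball_subset_cball_iff[of x' r' x r] by auto
  moreover have "x \<notin> cball x' r'" using assms(1,2) by auto
  ultimately show ?thesis by simp
qed

text \<open>The separation satisfied by the bases and radii of pairwise disjoint horoballs: two objects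
  of size at least \<open>s\<close> are at distance at least \<open>2 s\<close>.\<close>

definition sparse_sizes :: "('a::metric_space \<times> real) set \<Rightarrow> bool" where
  "sparse_sizes P \<longleftrightarrow> (\<forall>(y, s)\<in>P. 0 < s) \<and>
     (\<forall>(y, s)\<in>P. \<forall>(y', s')\<in>P. (y, s) \<noteq> (y', s') \<longrightarrow> 4 * s * s' \<le> (dist y y')\<^sup>2)"

text \<open>For the base points \<open>p/q\<close> with sizes \<open>1/q\<^sup>2\<close> in the real line these are the badly approximable
  numbers.\<close>

definition badly_approximable :: "('a::metric_space \<times> real) set \<Rightarrow> 'a set" where
  "badly_approximable P = {x. \<exists>\<epsilon>>0. \<forall>(y, s)\<in>P. \<epsilon> * s \<le> dist x y}"

lemma sparse_sizes_unique:
  assumes "sparse_sizes P" "(y, s) \<in> P" "(y', s') \<in> P" "0 < r"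
    and "2 * r \<le> s" "2 * r \<le> s'" "dist x y < 2 * r" "dist x y' < 2 * r"
  shows "y' = y"
proof (rule ccontr)
  assume "y' \<noteq> y"
  then have "4 * s * s' \<le> (dist y y')\<^sup>2" using assms by (fastforce simp: sparse_sizes_def)
  moreover have "dist y y' < 4 * r" using assms dist_triangle3[of y y' x] by simp
  then have "(dist y y')\<^sup>2 < (4 * r)\<^sup>2" by (intro power_strict_mono) auto
  moreover have "(2 * r) * (2 * r) \<le> s * s'" using assms by (intro mult_mono) auto
  ultimately show False by (simp add: power2_eq_square)
qed

text \<open>The list passed to a strategy contains Bob's moves \<open>0, \<dots>, k\<close>, so an even length means that \<open>k\<close> is
  odd. At even \<open>k\<close> Alice forces Bob to shrink. At odd \<open>k\<close> she blocks the only point of size at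
  least \<open>2 r\<close> that could be close to Bob's ball of radius \<open>r\<close>, if there is one. Only Bob's last move
  matters, because points of larger sizes have been dealt with when the radius was larger.\<close>

definition blocking_strategy :: "('a::metric_space \<times> real) set \<Rightarrow> real \<Rightarrow> ('a \<times> real) list \<Rightarrow> 'a \<times> real"
  where
  "blocking_strategy P \<beta> bs = (case last bs of (x, r) \<Rightarrow>
     (if even (length bs) \<and> (\<exists>(y, s)\<in>P. 2 * r \<le> s \<and> dist x y < 2 * r)
      then SOME y. \<exists>s. (y, s) \<in> P \<and> 2 * r \<le> s \<and> dist x y < 2 * r else x, \<beta> / 2))"

text \<open>A point that is at least \<open>2 r\<close> from the centre of Bob's ball is at least \<open>r\<close> from the outcome \<open>x\<close>;
  a closer one has been blocked, since at the relevant scale it is unique.\<close>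

lemma blocking_strategy_avoids:
  fixes B :: "nat \<Rightarrow> 'a::metric_space \<times> real"
  assumes "sparse_sizes P" "legal_play X \<beta> (blocking_strategy P \<beta>) B" "odd k" "0 < snd (B k)"
    and "(y, s) \<in> P" "2 * snd (B k) \<le> s"
    and "\<And>j. x \<in> cball (fst (B j)) (snd (B j))" "0 < \<beta>" "\<beta> < 1"
  shows "\<beta> / 2 * snd (B k) \<le> dist x y"
proof -
  obtain z r where B: "B k = (z, r)" by (cases "B k")
  have r: "0 < r" "2 * r \<le> s" "dist z x \<le> r" using assms(4,6) assms(7)[of k] B by auto
  show ?thesis
  proof (cases "dist z y < 2 * r")
    case True
    let ?Q = "\<lambda>y'. \<exists>s'. (y', s') \<in> P \<and> 2 * r \<le> s' \<and> dist z y' < 2 * r"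
    have y: "?Q y" using True r assms(5) by blast
    then have "(SOME y'. ?Q y') = y"
      using sparse_sizes_unique[OF assms(1) assms(5) _ r(1,2) _ True]
      by (intro some_equality) auto
    moreover have "\<exists>(y, s)\<in>P. 2 * r \<le> s \<and> dist z y < 2 * r" using y by blast
    ultimately have \<sigma>: "blocking_strategy P \<beta> (map B [0..<Suc k]) = (y, \<beta> / 2)"
      using assms(3) B by (simp add: blocking_strategy_def)
    obtain z' r' where B': "B (Suc k) = (z', r')" by (cases "B (Suc k)")
    from assms(2) have "let (x, r) = B k; (x', r') = B (Suc k);
        (y, \<alpha>) = blocking_strategy P \<beta> (map B [0..<Suc k])
      in cball x' r' \<subseteq> cball x r - cball y (\<alpha> * r) \<and> \<beta> * r \<le> r' \<and> r' \<le> r"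
      unfolding legal_play_def by blast
    then have "cball z' r' \<subseteq> cball z r - cball y (\<beta> / 2 * r)"
      unfolding \<sigma> B B' by simp
    then have "x \<notin> cball y (\<beta> / 2 * r)" using assms(7)[of "Suc k"] B' by auto
    then show ?thesis by (simp add: B dist_commute)
  next
    case False
    then have "r \<le> dist x y" using r dist_triangle[of z y x] by (simp add: dist_commute)
    moreover have "\<beta> / 2 * r \<le> 1 * r" using r assms by (intro mult_right_mono) auto
    ultimately show ?thesis by (simp add: B)
  qed
qed

text \<open>The outcome \<open>w\<close> exists by compactness and is in \<open>X\<close> because the radii tend to zero.
  A point \<open>y\<close> of size \<open>s\<close> is dealt with at the first odd time \<open>k\<close> with \<open>2 r\<^sub>k \<le> s\<close>. Two steps earlier the radius was still greater than \<open>s / 2\<close>,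
  and two steps multiply it by at least \<open>\<beta>\<^sup>2\<close>, so \<open>r\<^sub>k\<close> is comparable with \<open>s\<close> and avoiding a
  ball of radius \<open>\<beta> r\<^sub>k / 2\<close> suffices. For \<open>k = 1\<close> there is no earlier radius, and the upper bound \<open>M\<close> on
  all sizes takes its place.\<close>

lemma beta_absolute_winning_badly_approximable:
  fixes X :: "'a::euclidean_space set"
  assumes X: "closed X" and P: "sparse_sizes P" and M: "\<And>y s. (y, s) \<in> P \<Longrightarrow> s \<le> M"
    and \<beta>: "0 < \<beta>" "\<beta> < 1" and Y: "X \<inter> badly_approximable P \<subseteq> Y" "Y \<subseteq> X"
  shows "beta_absolute_winning \<beta> X Y"
  unfolding beta_absolute_winning_def
proof (intro conjI exI[of _ "blocking_strategy P \<beta>"] allI impI)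
  show "Y \<subseteq> X" by (rule Y(2))
  show "0 < snd (blocking_strategy P \<beta> bs)" "snd (blocking_strategy P \<beta> bs) < \<beta>" for bs
    using \<beta> by (simp_all add: blocking_strategy_def split: prod.split)
next
  fix B assume legal: "legal_play X \<beta> (blocking_strategy P \<beta>) B"
  define x r where "x k = fst (B k)" and "r k = snd (B k)" for k
  define C where "C k = cball (x k) (r k)" for k
  have B: "B k = (x k, r k)" for k by (simp add: x_def r_def)
  have step: "C (Suc k) \<subseteq> C k - cball y (\<alpha> * r k)" "\<beta> * r k \<le> r (Suc k)" "r (Suc k) \<le> r k"
    if "blocking_strategy P \<beta> (map B [0..<Suc k]) = (y, \<alpha>)" for k y \<alpha>
  proof -
    from legal have "let (x, r) = B k; (x', r') = B (Suc k);
        (y, \<alpha>) = blocking_strategy P \<beta> (map B [0..<Suc k])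
      in cball x' r' \<subseteq> cball x r - cball y (\<alpha> * r) \<and> \<beta> * r \<le> r' \<and> r' \<le> r"
      unfolding legal_play_def by blast
    then show "C (Suc k) \<subseteq> C k - cball y (\<alpha> * r k)" "\<beta> * r k \<le> r (Suc k)" "r (Suc k) \<le> r k"
      unfolding that B C_def by simp_all
  qed
  have dec: "C (Suc k) \<subseteq> C k" and lo: "\<beta> * r k \<le> r (Suc k)" and hi: "r (Suc k) \<le> r k" for k
    using step[of k] by (metis Diff_subset prod.exhaust order_trans)+
  have pos: "0 < r k" for k
  proof (induction k)
    case 0 then show ?case using legal by (simp add: legal_play_def r_def)
  next
    case (Suc k) then show ?case using lo[of k] \<beta> by (metis less_le_trans mult_pos_pos)
  qed
  have half: "r (Suc k) < r k / 2" if "even k" for k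
  proof -
    have "blocking_strategy P \<beta> (map B [0..<Suc k]) = (x k, \<beta> / 2)"
      using that by (simp add: blocking_strategy_def B)
    from step(1)[OF this] show ?thesis
      using pos[of k] pos[of "Suc k"] \<beta> unfolding C_def
      by (intro cball_avoiding_centre_radius) auto
  qed
  have geom: "r (2 * m) \<le> r 0 / 2 ^ m" for m
  proof (induction m)
    case (Suc m)
    have "r (2 * Suc m) \<le> r (2 * m) / 2" using hi[of "Suc (2 * m)"] half[of "2 * m"] by simp
    also have "\<dots> \<le> r 0 / 2 ^ m / 2" using Suc by simp
    finally show ?case by (simp add: field_simps)
  qed simp
  have small: "\<exists>m. r (2 * m) < \<epsilon>" if "0 < \<epsilon>" for \<epsilon>
  proof -
    have "(\<lambda>m. r 0 / 2 ^ m) \<longlonglongrightarrow> 0" by (rule LIMSEQ_divide_realpow_zero) simp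
    then have "\<forall>\<^sub>F m in sequentially. r 0 / 2 ^ m < \<epsilon>" using that by (rule order_tendstoD)
    then obtain m where "r 0 / 2 ^ m < \<epsilon>" using eventually_sequentially by auto
    then show ?thesis using geom[of m] by (intro exI[of _ m]) simp
  qed
  have "\<Inter>(range C) \<noteq> {}"
  proof (rule compact_nest)
    show "compact (C k)" "C k \<noteq> {}" for k using pos[of k] by (simp_all add: C_def)
    show "C k \<subseteq> C j" if "j \<le> k" for j k using lift_Suc_antimono_le[of C, OF dec that] .
  qed
  then obtain w where w: "\<And>k. w \<in> C k" by blast
  have "w \<in> X"
  proof -
    have "\<exists>z\<in>X. dist z w < \<epsilon>" if \<epsilon>: "0 < \<epsilon>" for \<epsilon>
    proof -
      obtain m where "r (2 * m) < \<epsilon>" using small[OF \<epsilon>] by blast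
      moreover have "x (2 * m) \<in> X" using legal by (simp add: legal_play_def x_def)
      ultimately show ?thesis using w[of "2 * m"] by (intro bexI[of _ "x (2 * m)"]) (auto simp: C_def)
    qed
    then show ?thesis using X by (metis closed_approachable)
  qed
  moreover have "w \<in> badly_approximable P"
  proof -
    have avoid: "\<beta> / 2 * r k \<le> dist w y" if "odd k" "(y, s) \<in> P" "2 * r k \<le> s" for k y s
      using blocking_strategy_avoids[OF P legal that(1) _ that(2)] that(3) pos w \<beta>
      unfolding C_def r_def x_def by blast
    \<comment> \<open>The second bound serves the points that are dealt with at time 1, the first one all others.\<close>
    define \<epsilon> where "\<epsilon> = min (\<beta> ^ 3 / 4) (\<beta> * r 1 / (2 * max M 1))"
    have \<epsilon>: "\<epsilon> > 0" using \<beta> pos[of 1] by (simp add: \<epsilon>_def)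
    have "\<epsilon> * s \<le> dist w y" if ys: "(y, s) \<in> P" for y s
    proof -
      have s: "0 < s" "s \<le> max M 1" using P M[OF ys] ys by (auto simp: sparse_sizes_def)
      define m where "m = (LEAST m. 2 * r (2 * m + 1) \<le> s)"
      have "\<exists>m. 2 * r (2 * m + 1) \<le> s"
      proof -
        obtain m where "r (2 * m) < s / 2" using small[of "s / 2"] s by auto
        then show ?thesis using hi[of "2 * m"] by (intro exI[of _ m]) simp
      qed
      then have m: "2 * r (2 * m + 1) \<le> s" unfolding m_def by (rule LeastI_ex)
      have dist: "\<beta> / 2 * r (2 * m + 1) \<le> dist w y" by (rule avoid[OF _ ys m]) simp
      show ?thesis
      proof (cases m)
        case 0
        have "\<epsilon> * s \<le> (\<beta> * r 1 / (2 * max M 1)) * max M 1"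
          using s \<epsilon> by (intro mult_mono) (auto simp: \<epsilon>_def)
        also have "\<dots> = \<beta> / 2 * r 1" by (simp add: field_simps max_def)
        finally show ?thesis using dist 0 by simp
      next
        case (Suc j)
        then have "s < 2 * r (2 * j + 1)" using not_less_Least[of j "\<lambda>m. 2 * r (2 * m + 1) \<le> s"]
          by (simp add: m_def)
        have "\<epsilon> * s \<le> (\<beta> ^ 3 / 4) * (2 * r (2 * j + 1))"
          using s \<epsilon> \<open>s < _\<close> by (intro mult_mono) (auto simp: \<epsilon>_def)
        also have "\<dots> = \<beta> / 2 * (\<beta> * (\<beta> * r (2 * j + 1)))" by (simp add: power3_eq_cube)
        also have "\<dots> \<le> \<beta> / 2 * (\<beta> * r (2 * j + 2))"
          using \<beta> lo[of "2 * j + 1"] by (intro mult_left_mono) auto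
        also have "\<dots> \<le> \<beta> / 2 * r (2 * m + 1)"
          using \<beta> lo[of "2 * j + 2"] Suc by (intro mult_left_mono) auto
        finally show ?thesis using dist by simp
      qed
    qed
    then show ?thesis using \<epsilon> by (auto simp: badly_approximable_def)
  qed
  ultimately show "(\<Inter>k. cball (fst (B k)) (snd (B k))) \<inter> Y \<noteq> {}"
    using w Y(1) unfolding C_def x_def r_def by blast
qed

section \<open>Disjoint horoballs\<close>

lemma ball_disjoint_imp_dist_ge:
  fixes x y :: "'a::real_normed_vector"
  assumes "ball x r \<inter> ball y s = {}" "0 < r" "0 < s"
  shows "r + s \<le> dist x y"
proof (rule ccontr)
  assume "\<not> r + s \<le> dist x y"
  then have d: "norm (y - x) < r + s" by (simp add: dist_norm norm_minus_commute)
  \<comment> \<open>The point dividing the segment in the ratio of the radii would lie in both balls.\<close>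
  define z where "z = x + (r / (r + s)) *\<^sub>R (y - x)"
  have "z - x = (r / (r + s)) *\<^sub>R (y - x)" by (simp add: z_def)
  moreover have "y - z = (s / (r + s)) *\<^sub>R (y - x)"
  proof -
    have "s / (r + s) = 1 - r / (r + s)" using assms by (simp add: field_simps)
    then have "(s / (r + s)) *\<^sub>R (y - x) = (y - x) - (r / (r + s)) *\<^sub>R (y - x)"
      by (simp only: scaleR_diff_left scaleR_one)
    then show ?thesis by (simp add: z_def)
  qed
  ultimately have "dist z x = r / (r + s) * norm (y - x)" "dist y z = s / (r + s) * norm (y - x)"
    using assms by (simp_all add: dist_norm)
  moreover have "t / (r + s) * norm (y - x) < t" if "0 < t" for t
    using mult_strict_left_mono[OF d that] assms by (simp add: pos_divide_less_eq)
  ultimately have "z \<in> ball x r" "z \<in> ball y s"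
    using assms by (simp_all add: dist_commute[of x z])
  then show False using assms(1) by blast
qed

text \<open>Horoballs not based at infinity, each encoded by its base point on the boundary and its
  Euclidean radius.\<close>

definition horoball_bases :: "('n::finite) hpoint set set \<Rightarrow> ((real^'n) \<times> real) set" where
  "horoball_bases \<H> = {(y, r). 0 < r \<and> ball (y, r) r \<in> \<H>}"

text \<open>Two distinct horoballs with bases \<open>y\<close>, \<open>y'\<close> and radii \<open>r\<close>, \<open>r'\<close> are disjoint Euclidean
  balls resting on the boundary, and Pythagoras gives
  \<open>\<bar>y - y'\<bar>\<^sup>2 \<ge> (r + r')\<^sup>2 - (r - r')\<^sup>2 = 4 r r'\<close>.\<close>

lemma sparse_sizes_horoball_bases:
  fixes \<H> :: "('n::finite) hpoint set set"
  assumes "disjoint \<H>"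
  shows "sparse_sizes (horoball_bases \<H>)"
proof -
  have "4 * r * r' \<le> (dist y y')\<^sup>2"
    if a: "(y, r) \<in> horoball_bases \<H>" and b: "(y', r') \<in> horoball_bases \<H>"
      and ne: "(y, r) \<noteq> (y', r')" for y y' :: "real^'n" and r r'
  proof -
    have r: "0 < r" "0 < r'" and mem: "ball (y, r) r \<in> \<H>" "ball (y', r') r' \<in> \<H>"
      using a b by (simp_all add: horoball_bases_def)
    have "ball (y, r) r \<noteq> ball (y', r') r'" using ne r by (auto simp: ball_eq_ball_iff)
    then have "ball (y, r) r \<inter> ball (y', r') r' = {}"
      using assms mem by (auto simp: disjoint_def)
    then have "r + r' \<le> dist (y, r) (y', r')" using r by (intro ball_disjoint_imp_dist_ge)
    then have "(r + r')\<^sup>2 \<le> (dist (y, r) (y', r'))\<^sup>2" using r by (intro power_mono) auto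
    also have "\<dots> = (dist y y')\<^sup>2 + (r - r')\<^sup>2" by (simp add: dist_Pair_Pair dist_real_def)
    finally show ?thesis by (simp add: power2_eq_square algebra_simps)
  qed
  moreover have "0 < r" if "(y, r) \<in> horoball_bases \<H>" for y r
    using that by (simp add: horoball_bases_def)
  ultimately show ?thesis unfolding sparse_sizes_def by blast
qed

text \<open>A larger ball would reach above height 1 and meet the horoball at infinity.\<close>

lemma horoball_bases_radius_le:
  assumes "disjoint \<H>" "{p. 1 < snd p} \<in> \<H>" "(y, r) \<in> horoball_bases \<H>"
  shows "r \<le> 1 / 2"
proof (rule ccontr)
  assume "\<not> r \<le> 1 / 2"
  then have r: "1 < 2 * r" by simp
  define h where "h = (1 + 2 * r) / 2"
  have "(y, h) \<in> ball (y, r) r" using r by (simp add: h_def dist_Pair_Pair dist_real_def)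
  moreover have "(y, h) \<in> {p. 1 < snd p}" using r by (simp add: h_def)
  ultimately have "ball (y, r) r = {p. 1 < snd p}"
    using assms disjointD[of \<H> "ball (y, r) r" "{p. 1 < snd p}"]
    unfolding horoball_bases_def by blast
  moreover have "(y, 1 / 2) \<in> ball (y, r) r" using r by (simp add: dist_Pair_Pair dist_real_def)
  ultimately show False by auto
qed

lemma horoball_below_infinity:
  assumes "disjoint \<H>" "\<forall>B\<in>\<H>. horoball B" "{p. 1 < snd p} \<in> \<H>" "B \<in> \<H>" "p \<in> B" "snd p \<le> 1"
  obtains y r where "(y, r) \<in> horoball_bases \<H>" "B = ball (y, r) r"
proof -
  have "horoball B" using assms by blast
  then consider s where "0 < s" "B = {p. s < snd p}" | y r where "0 < r" "B = ball (y, r) r"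
    by (auto simp: horoball_def)
  then show ?thesis
  proof cases
    case 1
    then have "(fst p, 1 + s) \<in> B \<inter> {p. 1 < snd p}" by simp
    then have "B = {p. 1 < snd p}" using disjointD[OF assms(1,4,3)] by blast
    then show ?thesis using assms(5,6) by simp
  next
    case 2 then show ?thesis using that[of y r] assms(4) by (simp add: horoball_bases_def)
  qed
qed

lemma horoball_open: "horoball B \<Longrightarrow> open B"
proof -
  have "open {p :: 'a hpoint. s < snd p}" for s by (intro open_Collect_less continuous_intros)
  then show "horoball B \<Longrightarrow> open B" by (auto simp: horoball_def)
qed

text \<open>An open set that meets the closure of a horoball meets the horoball itself. This makes the height
  function at most zero on the frontier of a lifted horoball, which is where the depth of a
  geodesic in the horoball is measured from.\<close>

lemma frontier_horoball_not_covered: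
  assumes "disjoint \<H>" "\<forall>B\<in>\<H>. horoball B" "B \<in> \<H>" "q \<in> frontier B"
  shows "q \<notin> \<Union>\<H>"
proof
  assume "q \<in> \<Union>\<H>"
  then obtain B' where B': "B' \<in> \<H>" "q \<in> B'" by blast
  have "open B" "open B'" using assms B' horoball_open by blast+
  then have "B \<noteq> B'" using assms(4) B'(2) by (auto simp: frontier_def interior_open)
  then have "B \<inter> B' = {}" using assms B' by (auto simp: disjoint_def)
  then have "closure B \<inter> B' = {}" using \<open>open B'\<close> by (metis inf_commute open_Int_closure_eq_empty)
  then show False using assms(4) B'(2) by (auto simp: frontier_def)
qed

text \<open>The vertical geodesic over \<open>x\<close> is inside \<open>ball (y, r) r\<close> between the two heights whose sum is
  \<open>2 r\<close> and whose product is \<open>\<bar>x - y\<bar>\<^sup>2\<close>. So heights inside are between \<open>\<bar>x - y\<bar>\<^sup>2 / (2 r)\<close> and \<open>2 r\<close>,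
  and their hyperbolic distance to the upper exit point depends on the ratio \<open>\<bar>x - y\<bar> / r\<close> only.\<close>

lemma vertical_depth_in_horoball:
  fixes x y :: "real^'n"
  assumes "(x, t) \<in> ball (y, r) r" "0 < \<epsilon>" "\<epsilon> * r \<le> dist x y"
  obtains q where "q \<in> frontier (ball (y, r) r)" "q \<in> upper" "hdist (x, t) q \<le> arcosh (1 + 4 / \<epsilon>\<^sup>2)"
proof -
  \<comment> \<open>\<open>(x, u)\<close> is the upper one of the two points of the vertical line on the frontier.\<close>
  define d u where "d = dist x y" and "u = r + sqrt (r\<^sup>2 - d\<^sup>2)"
  have r: "0 < r" using assms(1) by (metis ball_empty empty_iff not_le)
  have "0 < \<epsilon> * r" using assms(2) r by simp
  then have d: "0 < d" "\<epsilon> * r \<le> d" using assms(3) unfolding d_def by linarith+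
  have "(dist (y, r) (x, t))\<^sup>2 < r\<^sup>2" using assms(1) by (intro power_strict_mono) (auto simp: mem_ball)
  then have lt: "d\<^sup>2 + (t - r)\<^sup>2 < r\<^sup>2"
    by (simp add: dist_Pair_Pair dist_real_def d_def dist_commute power2_commute)
  then have dr: "d\<^sup>2 \<le> r\<^sup>2" by (smt (verit) zero_le_power2)
  have t2: "(t - r)\<^sup>2 - r\<^sup>2 \<ge> - (2 * r * t)" by (simp add: power2_eq_square algebra_simps)
  then have t: "d\<^sup>2 < 2 * r * t" using lt by linarith
  then have "0 < 2 * r * t" by (smt (verit) zero_le_power2)
  then have t0: "0 < t" using r by (simp add: zero_less_mult_iff)
  have "(t - r)\<^sup>2 \<le> r\<^sup>2" using lt by (smt (verit) zero_le_power2)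
  then have tr: "\<bar>t - r\<bar> \<le> r" using r by (metis abs_le_square_iff abs_of_pos)
  have u: "r \<le> u" "u \<le> 2 * r"
    using dr r by (auto simp: u_def intro!: real_le_lsqrt)
  have "(dist (y, r) (x, u))\<^sup>2 = r\<^sup>2"
    using dr by (simp add: dist_Pair_Pair dist_real_def d_def dist_commute u_def)
  then have "dist (y, r) (x, u) = r" using r by (simp add: power2_eq_iff_nonneg)
  then have fr: "(x, u) \<in> frontier (ball (y, r) r)" using r by (simp add: frontier_ball)
  have "hcosh (x, t) (x, u) = 1 + (t - u)\<^sup>2 / (2 * t * u)"
    by (simp add: hcosh_def dist_Pair_Pair dist_real_def)
  also have "(t - u)\<^sup>2 / (2 * t * u) \<le> (2 * r)\<^sup>2 / (2 * t * r)"
  proof (rule frac_le)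
    have "\<bar>t - u\<bar> \<le> \<bar>2 * r\<bar>" using tr u t0 r by auto
    then show "(t - u)\<^sup>2 \<le> (2 * r)\<^sup>2" by (simp only: abs_le_square_iff)
  qed (use u t0 r in auto)
  also have "(2 * r)\<^sup>2 / (2 * t * r) = 4 * r\<^sup>2 / (2 * r * t)" by (simp add: power2_eq_square)
  also have "\<dots> \<le> 4 * r\<^sup>2 / d\<^sup>2" using t t0 d r by (intro divide_left_mono) auto
  also have "\<dots> \<le> 4 * r\<^sup>2 / (\<epsilon> * r)\<^sup>2"
    using d r assms(2) by (intro divide_left_mono power_mono) auto
  also have "\<dots> = 4 / \<epsilon>\<^sup>2" using r by (simp add: power_mult_distrib)
  finally have "hcosh (x, t) (x, u) \<le> 1 + 4 / \<epsilon>\<^sup>2" by simp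
  moreover have up: "(x, t) \<in> upper" "(x, u) \<in> upper" using t0 u r by (auto simp: upper_def)
  ultimately have "hdist (x, t) (x, u) \<le> arcosh (1 + 4 / \<epsilon>\<^sup>2)"
    unfolding hdist_eq_arcosh using hcosh_ge_1[OF up] by (intro arcosh_le) auto
  then show ?thesis using that fr up by blast
qed

section \<open>Boundedness of vertical geodesics\<close>

lemma qgeodesic_vertical:
  assumes "hyperbolic_group \<Gamma>"
  shows "qgeodesic \<Gamma> (vertical \<Gamma> x) t = orbit \<Gamma> (x, exp (- t))"
proof -
  let ?u0 = "((x, 1), (0, -1)) :: 'a htangent"
  have u0: "hgeodesic ?u0 t = (x, exp (- t))" for t
    by (simp add: hgeodesic_def cosh_plus_sinh exp_minus inverse_eq_divide)
  have "?u0 \<in> vertical \<Gamma> x"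
    using assms by (auto simp: vertical_def tproj_def unit_tangent_def upper_def
        hyperbolic_group_def norm_Pair intro!: bexI[of _ id])
  then have "(SOME u. u \<in> vertical \<Gamma> x) \<in> vertical \<Gamma> x" by (rule someI)
  then obtain g where g: "g \<in> \<Gamma>"
    and eq: "hgeodesic (SOME u. u \<in> vertical \<Gamma> x) t = g (x, exp (- t))"
    by (auto simp: vertical_def tproj_def u0)
  have p: "(x, exp (- t)) \<in> upper" by (simp add: upper_def)
  note D = hyperbolic_groupD[OF assms]
  \<comment> \<open>The chosen representative is a \<open>\<Gamma>\<close>-translate of the vertical vector, so its orbits are the same.\<close>
  have "orbit \<Gamma> (g p) = orbit \<Gamma> p" if "p \<in> upper" for p
  proof
    show "orbit \<Gamma> (g p) \<subseteq> orbit \<Gamma> p"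
      unfolding orbit_def using D(5)[OF _ g] by (intro image_subsetI image_eqI[of _ _ "_ \<circ> g"]) auto
    show "orbit \<Gamma> p \<subseteq> orbit \<Gamma> (g p)"
    proof
      fix z assume "z \<in> orbit \<Gamma> p"
      then obtain h where "h \<in> \<Gamma>" "z = h p" by (auto simp: orbit_def)
      then show "z \<in> orbit \<Gamma> (g p)" using D(3,5) g D(4)[OF g, of p]
        by (auto simp: orbit_def intro!: image_eqI[of _ _ "h \<circ> inv g"])
    qed
  qed
  then show ?thesis unfolding qgeodesic_def eq using p by blast
qed

text \<open>The height is at most zero outside the lifted horoballs. Inside one of them it grows at most as fast
  as the distance to the frontier, which is bounded uniformly over all horoballs by the condition
  on \<open>x\<close>. The horoball at infinity is never entered for nonnegative times.\<close>

lemma total_height_vertical_finite: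
  fixes \<Gamma> :: "(('n::finite) hpoint \<Rightarrow> 'n hpoint) set"
  assumes \<Gamma>: "hyperbolic_group \<Gamma>" "e \<in> cusps \<Gamma>" "height_function \<Gamma> e \<beta>"
    and \<H>: "lifted_horoballs \<Gamma> \<beta> \<H>" "{p. 1 < snd p} \<in> \<H>"
    and x: "x \<in> badly_approximable (horoball_bases \<H>)"
  shows "total_height \<Gamma> \<beta> (vertical \<Gamma> x) < \<infinity>"
proof -
  obtain \<epsilon> where \<epsilon>: "0 < \<epsilon>" "\<And>y r. (y, r) \<in> horoball_bases \<H> \<Longrightarrow> \<epsilon> * r \<le> dist x y"
    using x by (auto simp: badly_approximable_def)
  have dis: "disjoint \<H>" and hb: "\<forall>B\<in>\<H>. horoball B"
    and Un: "\<Union>\<H> = {p\<in>upper. 0 < \<beta> (orbit \<Gamma> p)}"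
    using \<H>(1) by (simp_all add: lifted_horoballs_def)
  define K where "K = arcosh (1 + 4 / \<epsilon>\<^sup>2)"
  have "0 \<le> K" unfolding K_def by (rule arcosh_nonneg_real) simp
  have "\<beta> (orbit \<Gamma> (x, exp (- t))) \<le> K" if "0 \<le> t" for t
  proof -
    let ?p = "(x, exp (- t))"
    have p: "?p \<in> upper" by (simp add: upper_def)
    show ?thesis
    proof (cases "?p \<in> \<Union>\<H>")
      case True
      then obtain B where B: "B \<in> \<H>" "?p \<in> B" by blast
      have "snd ?p \<le> 1" using that by simp
      then obtain y r where yr: "(y, r) \<in> horoball_bases \<H>" "B = ball (y, r) r"
        using horoball_below_infinity[OF dis hb \<H>(2) B] by blast
      obtain q where q: "q \<in> frontier B" "q \<in> upper" "hdist ?p q \<le> K"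
        using vertical_depth_in_horoball[OF _ \<epsilon>(1) \<epsilon>(2)[OF yr(1)]] B(2) yr(2)
        unfolding K_def by blast
      have "\<beta> (orbit \<Gamma> q) \<le> 0"
        using frontier_horoball_not_covered[OF dis hb B(1) q(1)] Un q(2) by auto
      then show ?thesis using height_function_lipschitz[OF \<Gamma> p q(2)] q(3) by linarith
    next
      case False
      then show ?thesis using Un p \<open>0 \<le> K\<close> by auto
    qed
  qed
  then have "total_height \<Gamma> \<beta> (vertical \<Gamma> x) \<le> ereal K"
    unfolding total_height_def qgeodesic_vertical[OF \<Gamma>(1)] by (intro SUP_least) auto
  then show ?thesis by (rule le_less_trans) simp
qed

theorem theorem1p3:
  assumes "2 \<le> CARD('n::finite)"
  shows "\<exists>\<beta>s :: (real^'n) set \<Rightarrow> real.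
    (\<forall>X. 0 < \<beta>s X) \<and>
    (\<forall>(\<Gamma> :: ('n hpoint \<Rightarrow> 'n hpoint) set) e \<beta> \<H> c0 a \<rho>.
       hyperbolic_group \<Gamma> \<and> finite_volume \<Gamma> \<and> noncompact_quot \<Gamma> \<and>
       e \<in> cusps \<Gamma> \<and> height_function \<Gamma> e \<beta> \<and>
       lifted_horoballs \<Gamma> \<beta> \<H> \<and> {p. 1 < snd p} \<in> \<H> \<and>
       0 < c0 \<and> 0 < \<rho> \<and> sphere a \<rho> \<subseteq> S_tilde \<Gamma> \<beta> \<H> c0
       \<longrightarrow> absolute_winning (\<beta>s (sphere a \<rho>)) (sphere a \<rho>)
             (B_tilde \<Gamma> \<beta> \<H> c0 \<inter> sphere a \<rho>))"
  \<comment> \<open>The game argument works for all parameters below 1, whatever the sphere.\<close>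
proof (intro exI[of _ "\<lambda>_. 1"] conjI allI impI)
  fix \<Gamma> :: "('n hpoint \<Rightarrow> 'n hpoint) set" and e \<beta> \<H> c0 a and \<rho> :: real
  assume *: "hyperbolic_group \<Gamma> \<and> finite_volume \<Gamma> \<and> noncompact_quot \<Gamma> \<and>
       e \<in> cusps \<Gamma> \<and> height_function \<Gamma> e \<beta> \<and>
       lifted_horoballs \<Gamma> \<beta> \<H> \<and> {p. 1 < snd p} \<in> \<H> \<and>
       0 < c0 \<and> 0 < \<rho> \<and> sphere a \<rho> \<subseteq> S_tilde \<Gamma> \<beta> \<H> c0"
  then have dis: "disjoint \<H>" by (simp add: lifted_horoballs_def)
  have "sphere a \<rho> \<inter> badly_approximable (horoball_bases \<H>) \<subseteq> B_tilde \<Gamma> \<beta> \<H> c0 \<inter> sphere a \<rho>"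
    using * total_height_vertical_finite[of \<Gamma> e \<beta> \<H>]
    by (auto simp: B_tilde_def S_tilde_def bounded_vectors_def first_height_set_def)
  then show "absolute_winning 1 (sphere a \<rho>) (B_tilde \<Gamma> \<beta> \<H> c0 \<inter> sphere a \<rho>)"
    unfolding absolute_winning_def
    using * horoball_bases_radius_le[OF dis]
    by (intro allI impI beta_absolute_winning_badly_approximable[OF closed_sphere
          sparse_sizes_horoball_bases[OF dis], where M = "1 / 2"]) blast+
qed simp

end
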